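(* Let $m,d\geq 1$ be integers and let $f: S^m\rightarrow \mathbb{R}^d$ be a continuous map such that $f(-p)=-f(p)$ for all $p\in S^m$. Suppose that $md< N'$, where $$N'=\min\left\{j \;\middle|\; 2\leq j\leq m+1,\ \binom{m+1}{j}\equiv 1 \pmod 2\right\}.$$ Then there are $m+1$ points $p_1, \ldots, p_{m+1}$ in $S^m$ such that $f(p_1)=\cdots=f(p_{m+1})$, where $p_1, \ldots, p_{m+1}$ are linearly dependent and any $m$ points of $p_1, \ldots, p_{m+1}$ are linearly independent.
   Context: $S^m$ denotes the unit sphere in $\mathbb{R}^{m+1}$; linear (in)dependence refers to the points regarded as vectors of $\mathbb{R}^{m+1}$. "Any $m$ points of $p_1,\ldots,p_{m+1}$" means the family $(p_i)_{i\in I}$ for any subset $I\subset\{1,\ldots,m+1\}$ with $m$ elements; likewise, linear dependence of $p_1,\ldots,p_{m+1}$ is that of the indexed family. *)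

theory Defs
  imports "HOL-Analysis.Analysis" "HOL-Number_Theory.Cong"
begin

text \<open>
  The library predicate \<open>independent\<close> is about sets of vectors.  Linear independence
  of an indexed family \<open>p i (i \<in> I)\<close> differs from independence of the image
  \<open>p ` I\<close> in that a family with a repeated vector is dependent.
\<close>

definition lin_indep_family :: "'i set \<Rightarrow> ('i \<Rightarrow> 'a::real_vector) \<Rightarrow> bool" where
  "lin_indep_family I p \<longleftrightarrow>
     (\<forall>c :: 'i \<Rightarrow> real. (\<Sum>i\<in>I. c i *\<^sub>R p i) = 0 \<longrightarrow> (\<forall>i\<in>I. c i = 0))"
  \<comment> \<open>intended for finite \<open>I\<close> only\<close>

text \<open>
  The set is finite, and it contains \<open>m + 1\<close> when \<open>m \<ge> 1\<close>, so the minimum is then attained.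
\<close>

definition N' :: "nat \<Rightarrow> nat" where
  "N' m = Min {j. 2 \<le> j \<and> j \<le> m + 1 \<and> [(m + 1) choose j = 1] (mod 2)}"

end

theory Submission
  imports Defs
begin

text \<open>
  Since \<open>m + 1\<close> itself competes in the minimum, \<open>N' m \<le> m + 1\<close>, so \<open>m * d < N' m\<close> forces
  \<open>d = 1\<close>; and \<open>m = 2\<close> is excluded because \<open>3 choose 2\<close> is odd.  For \<open>m = 1\<close> a repeated
  point will do.  What remains is a question about an odd real function \<open>f\<close> on a sphere and
  \<open>m \<ge> 3\<close>, which the intermediate value theorem and a little linear algebra settle.

  Choose a unit vector \<open>p\<close> with \<open>f p > 0\<close> and a level \<open>c\<close> strictly between \<open>0\<close> and \<open>f p\<close>.
  Every open half great circle from \<open>- p\<close> to \<open>p\<close> meets the level set of \<open>c\<close>.  So for each \<open>u\<close>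
  independent of \<open>p\<close> some positive multiple of \<open>u + a p\<close>, and likewise some positive multiple
  of \<open>- (u + b p)\<close>, lies in the level set.  Oddness and \<open>c \<noteq> 0\<close> give \<open>a \<noteq> b\<close>: over the line of
  \<open>u\<close> there are two different heights to choose from (lemma \<open>odd_level_antipodal_pair\<close>,
  which also covers \<open>f = 0\<close>).

  Now put \<open>k = m - 1\<close>, extend \<open>p\<close> by vectors \<open>v\<^sub>1, \<dots>, v\<^sub>k\<close> to an independent family and let
  \<open>w = v\<^sub>1 + \<dots> + v\<^sub>k\<close>.  Take one height \<open>s\<^sub>i\<close> over each \<open>v\<^sub>i\<close> and both heights \<open>\<alpha>\<close> and \<open>\<beta>\<close>
  over \<open>w\<close>.  These are \<open>m + 1\<close> vectors in a space of dimension \<open>m\<close>, hence dependent, and any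
  \<open>m\<close> of them are independent as soon as \<open>\<Sum> s\<^sub>i\<close> is neither \<open>\<alpha>\<close> nor \<open>\<beta>\<close>
  (lemma \<open>graph_family_circuit\<close>).  As \<open>k \<ge> 2\<close>, two of the heights can be chosen
  independently of each other, which yields at least three values of the sum, one of which
  avoids both \<open>\<alpha>\<close> and \<open>\<beta>\<close> (lemma \<open>binary_choices_sum_avoiding_two_values\<close>).
\<close>

section \<open>Linearly independent families\<close>

lemma lin_indep_familyD:
  assumes "lin_indep_family I p" "(\<Sum>i\<in>I. c i *\<^sub>R p i) = 0" "i \<in> I"
  shows "c i = 0"
  using assms unfolding lin_indep_family_def by blast

lemma lin_indep_family_if_independent:
  assumes "finite I" "inj_on p I" "independent (p ` I)"
  shows "lin_indep_family I p"
  unfolding lin_indep_family_def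
proof (intro allI impI ballI)
  fix c i assume 0: "(\<Sum>i\<in>I. c i *\<^sub>R p i) = 0" and i: "i \<in> I"
  let ?g = "\<lambda>x. c (inv_into I p x)"
  have "(\<Sum>x\<in>p ` I. ?g x *\<^sub>R x) = (\<Sum>i\<in>I. c i *\<^sub>R p i)"
    using assms(2) by (simp add: sum.reindex)
  with 0 have "?g (p i) = 0"
    using independentD[OF assms(3), of "p ` I" ?g "p i"] assms(1) i by auto
  then show "c i = 0" using assms(2) i by simp
qed

lemma lin_indep_family_subset:
  assumes "lin_indep_family J p" "I \<subseteq> J" "finite J"
  shows "lin_indep_family I p"
  unfolding lin_indep_family_def
proof (intro allI impI ballI)
  fix c i assume 0: "(\<Sum>i\<in>I. c i *\<^sub>R p i) = 0" and i: "i \<in> I"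
  have "(\<Sum>j\<in>J. (if j \<in> I then c j else 0) *\<^sub>R p j) = (\<Sum>i\<in>I. c i *\<^sub>R p i)"
    using assms(2,3) by (intro sum.mono_neutral_cong_right) auto
  with 0 show "c i = 0"
    using lin_indep_familyD[OF assms(1), of "\<lambda>j. if j \<in> I then c j else 0" i] i assms(2) by auto
qed

lemma lin_indep_family_scaleR_iff:
  assumes "\<And>i. i \<in> I \<Longrightarrow> \<mu> i \<noteq> 0"
  shows "lin_indep_family I (\<lambda>i. \<mu> i *\<^sub>R p i) \<longleftrightarrow> lin_indep_family I p"
proof
  assume L: "lin_indep_family I (\<lambda>i. \<mu> i *\<^sub>R p i)"
  show "lin_indep_family I p"
    unfolding lin_indep_family_def
  proof (intro allI impI ballI)
    fix c i assume 0: "(\<Sum>i\<in>I. c i *\<^sub>R p i) = 0" and i: "i \<in> I"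
    have "(\<Sum>i\<in>I. (c i / \<mu> i) *\<^sub>R \<mu> i *\<^sub>R p i) = (\<Sum>i\<in>I. c i *\<^sub>R p i)"
      using assms by (intro sum.cong) auto
    with 0 show "c i = 0" using lin_indep_familyD[OF L, of "\<lambda>i. c i / \<mu> i" i] i assms by auto
  qed
next
  assume L: "lin_indep_family I p"
  show "lin_indep_family I (\<lambda>i. \<mu> i *\<^sub>R p i)"
    unfolding lin_indep_family_def
  proof (intro allI impI ballI)
    fix c i assume 0: "(\<Sum>i\<in>I. c i *\<^sub>R \<mu> i *\<^sub>R p i) = 0" and i: "i \<in> I"
    then show "c i = 0" using lin_indep_familyD[OF L, of "\<lambda>i. c i * \<mu> i" i] assms by auto
  qed
qed

lemma exists_lin_indep_family_extending:
  fixes p :: "'a::euclidean_space"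
  assumes "p \<noteq> 0" "k < DIM('a)"
  obtains v where "v 0 = p" "lin_indep_family {0..k} v"
proof -
  \<comment> \<open>A basis through \<open>p\<close> is thinned out to the required size and then enumerated.\<close>
  have "independent {p}" using assms(1) by (simp add: dependent_single)
  then obtain B where B: "{p} \<subseteq> B" "independent B" "UNIV \<subseteq> span B"
    using maximal_independent_subset_extend[of "{p}" UNIV] by auto
  have fin: "finite B" using B(2) by (rule independent_imp_finite)
  have "card B = DIM('a)" using B by (metis basis_card_eq_dim dim_UNIV top_greatest)
  then have "k \<le> card (B - {p})" using assms(2) fin B(1) by (simp add: card_Diff_singleton)
  then obtain T where T: "T \<subseteq> B - {p}" "card T = k" by (metis obtain_subset_with_card_n)
  have "finite T" using T fin by (meson finite_Diff finite_subset)
  then obtain h where h: "bij_betw h {1..k} T"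
    using T(2) by (metis finite_same_card_bij card_atLeastAtMost diff_Suc_1 finite_atLeastAtMost)
  define v where "v = h(0 := p)"
  have img: "v ` {0..k} = insert p T"
  proof -
    have "{0..k} = insert 0 {1..k}" by auto
    moreover have "v ` {1..k} = h ` {1..k}" by (intro image_cong) (auto simp: v_def)
    ultimately show ?thesis using bij_betw_imp_surj_on[OF h] by (metis image_insert fun_upd_same v_def)
  qed
  have "card (v ` {0..k}) = card {0..k}"
    unfolding img using \<open>finite T\<close> T by (auto simp: card_insert_if)
  then have "inj_on v {0..k}" by (intro eq_card_imp_inj_on) auto
  moreover have "independent (v ` {0..k})"
    unfolding img using T B by (intro independent_mono[OF B(2)]) auto
  ultimately show ?thesis
    by (intro that[of v] lin_indep_family_if_independent) (auto simp: v_def)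
qed

section \<open>Level sets of odd functions\<close>

text \<open>
  By oddness \<open>f\<close> runs from \<open>- f p\<close> to \<open>f p\<close> along the half great circle from \<open>- p\<close> through
  \<open>u\<close> to \<open>p\<close>.  Since \<open>c\<close> is neither end value it is attained in the interior of the half circle,
  whose points are exactly the directions \<open>u + a p\<close>.
\<close>

lemma odd_level_on_half_circle:
  fixes f :: "'a::real_normed_vector \<Rightarrow> real"
  assumes cont: "continuous_on (sphere 0 1) f"
    and odd: "\<And>x. norm x = 1 \<Longrightarrow> f (- x) = - f x"
    and p: "norm p = 1" and c: "\<bar>c\<bar> < f p"
    and indep: "\<And>s t. s *\<^sub>R u + t *\<^sub>R p = 0 \<Longrightarrow> s = 0 \<and> t = 0"
  obtains a where "f (sgn (u + a *\<^sub>R p)) = c"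
proof -
  \<comment> \<open>A polygonal path with the same directions as the half circle, on a compact interval.\<close>
  define g where "g t = (1 - \<bar>t\<bar>) *\<^sub>R u + t *\<^sub>R p" for t :: real
  have nz: "g t \<noteq> 0" for t
    using indep[of "1 - \<bar>t\<bar>" t] unfolding g_def by auto
  have "continuous_on {-1..1} (\<lambda>t. sgn (g t))"
    unfolding sgn_div_norm using nz unfolding g_def by (intro continuous_intros) auto
  then have "continuous_on {-1..1} (\<lambda>t. f (sgn (g t)))"
    by (rule continuous_on_compose2[OF cont]) (auto simp: norm_sgn nz)
  moreover have e1: "f (sgn (g 1)) = f p" and e2: "f (sgn (g (-1))) = - f p"
    using odd[OF p] p by (auto simp: g_def sgn_div_norm)
  ultimately have "\<exists>t\<ge>-1. t \<le> 1 \<and> f (sgn (g t)) = c"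
    using c by (intro IVT') auto
  then obtain t where t: "-1 \<le> t" "t \<le> 1" "f (sgn (g t)) = c" by blast
  have "t \<noteq> 1" "t \<noteq> -1" using t e1 e2 c by auto
  then have pos: "1 - \<bar>t\<bar> > 0" using t by auto
  have "g t = (1 - \<bar>t\<bar>) *\<^sub>R (u + (t / (1 - \<bar>t\<bar>)) *\<^sub>R p)"
    using pos by (simp add: g_def scaleR_right_distrib)
  then have "sgn (g t) = sgn (u + (t / (1 - \<bar>t\<bar>)) *\<^sub>R p)"
    using pos by (simp add: sgn_scaleR)
  then show ?thesis using t that by metis
qed

text \<open>
  Apply the previous lemma to \<open>u\<close> and to \<open>- u\<close>.  If the two heights agreed, the level set of
  \<open>c\<close> would contain a pair of antipodes, which oddness forbids for \<open>c \<noteq> 0\<close>.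
  The other extreme is \<open>f = 0\<close>, where any two heights serve.
\<close>

lemma odd_level_antipodal_pair:
  fixes f :: "'a::euclidean_space \<Rightarrow> real"
  assumes cont: "continuous_on (sphere 0 1) f"
    and odd: "\<And>x. norm x = 1 \<Longrightarrow> f (- x) = - f x"
  obtains p c where "norm p = 1"
    "\<And>u. (\<And>s t. s *\<^sub>R u + t *\<^sub>R p = 0 \<Longrightarrow> s = 0 \<and> t = 0) \<Longrightarrow>
       \<exists>a b. a \<noteq> b \<and> f (sgn (u + a *\<^sub>R p)) = c \<and> f (sgn (- (u + b *\<^sub>R p))) = c"
proof (cases "\<exists>p. norm p = 1 \<and> f p > 0")
  case True
  then obtain p where p: "norm p = 1" "f p > 0" by blast
  \<comment> \<open>Any level strictly between \<open>0\<close> and \<open>f p\<close> would do.\<close>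
  define c where "c = f p / 2"
  have c: "\<bar>c\<bar> < f p" "c \<noteq> 0" using p by (auto simp: c_def)
  have "\<exists>a b. a \<noteq> b \<and> f (sgn (u + a *\<^sub>R p)) = c \<and> f (sgn (- (u + b *\<^sub>R p))) = c"
    if ind: "\<And>s t. s *\<^sub>R u + t *\<^sub>R p = 0 \<Longrightarrow> s = 0 \<and> t = 0" for u
  proof -
    obtain a where a: "f (sgn (u + a *\<^sub>R p)) = c"
      using odd_level_on_half_circle[OF cont odd p(1) c(1) ind] by blast
    have "s = 0 \<and> t = 0" if "s *\<^sub>R (- u) + t *\<^sub>R p = 0" for s t
      using ind[of "-s" t] that by simp
    then obtain b where b: "f (sgn (- u + b *\<^sub>R p)) = c"
      using odd_level_on_half_circle[OF cont odd p(1) c(1), of "- u"] by blast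
    have b': "f (sgn (- (u + (- b) *\<^sub>R p))) = c" using b by simp
    have "u + a *\<^sub>R p \<noteq> 0" using ind[of 1 a] by auto
    then have "f (sgn (- (u + a *\<^sub>R p))) = - c"
      unfolding sgn_minus using odd[of "sgn (u + a *\<^sub>R p)"] a by (simp add: norm_sgn)
    then have "a \<noteq> - b" using b' c(2) by auto
    with a b' show ?thesis by blast
  qed
  then show ?thesis using that p(1) by blast
next
  case False
  have zero: "f x = 0" if "norm x = 1" for x
    using False odd[OF that] that by (metis linorder_neqE_linordered_idom neg_0_less_iff_less norm_minus_cancel)
  obtain p :: 'a where p: "p \<in> Basis" using nonempty_Basis by blast
  show ?thesis
  proof (rule that[of p 0])
    show "norm p = 1" using p by simp
  next
    fix u assume ind: "\<And>s t. s *\<^sub>R u + t *\<^sub>R p = 0 \<Longrightarrow> s = 0 \<and> t = 0"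
    have "u + a *\<^sub>R p \<noteq> 0" for a using ind[of 1 a] by auto
    then have "f (sgn (u + a *\<^sub>R p)) = 0 \<and> f (sgn (- (u + a *\<^sub>R p))) = 0" for a
      unfolding sgn_minus by (simp add: zero norm_sgn)
    then show "\<exists>a b. a \<noteq> b \<and> f (sgn (u + a *\<^sub>R p)) = 0 \<and> f (sgn (- (u + b *\<^sub>R p))) = 0"
      using zero_neq_one by blast
  qed
qed

section \<open>General position\<close>

text \<open>
  Vary only two of the summands.  The sum of two independent choices, each between different
  numbers, takes at least three values: both smaller numbers, both larger ones, and a mixed
  choice strictly in between.
\<close>

lemma binary_choices_sum_avoiding_two_values:
  fixes a b :: "'i \<Rightarrow> real"
  assumes "finite K" "card K \<ge> 2" and ne: "\<And>i. i \<in> K \<Longrightarrow> a i \<noteq> b i"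
  obtains s where "\<And>i. s i = a i \<or> s i = b i" "sum s K \<noteq> \<alpha>" "sum s K \<noteq> \<beta>"
proof -
  obtain i j where ij: "i \<in> K" "j \<in> K" "i \<noteq> j"
    using assms(2) by (metis card_2_iff' obtain_subset_with_card_n subsetD)
  define R where "R = sum a (K - {i, j})"
  have S: "sum (a(i := x, j := y)) K = x + y + R" for x y
  proof -
    have "sum (a(i := x, j := y)) K = sum (a(i := x, j := y)) {i, j} + sum (a(i := x, j := y)) (K - {i, j})"
      using ij assms(1) by (subst sum.subset_diff[of "{i,j}"]) (auto simp: add.commute)
    moreover have "sum (a(i := x, j := y)) (K - {i, j}) = R"
      unfolding R_def by (intro sum.cong) auto
    ultimately show ?thesis using ij by simp
  qed
  have "\<exists>x\<in>{a i, b i}. \<exists>y\<in>{a j, b j}. x + y + R \<noteq> \<alpha> \<and> x + y + R \<noteq> \<beta>"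
    using ne[OF ij(1)] ne[OF ij(2)] by (simp; argo)
  then obtain x y where xy: "x \<in> {a i, b i}" "y \<in> {a j, b j}" "x + y + R \<noteq> \<alpha>" "x + y + R \<noteq> \<beta>"
    by blast
  show ?thesis
    by (rule that[of "a(i := x, j := y)"]) (use xy S in auto)
qed

text \<open>
  Compare coefficients of \<open>v 0, \<dots>, v k\<close>.  The two conditions say that the relations form a
  one-dimensional space unless \<open>\<alpha>\<close> and \<open>\<beta>\<close> both equal \<open>sum s {1..k}\<close>: the last two
  coefficients satisfy one linear equation and determine all the others.
\<close>

lemma graph_family_relation_iff:
  fixes v :: "nat \<Rightarrow> 'a::real_vector"
  assumes "lin_indep_family {0..k} v"
    and r: "\<And>i. i \<in> {1..k} \<Longrightarrow> r i = v i + s i *\<^sub>R v 0"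
      "r (k + 1) = (\<Sum>i=1..k. v i) + \<alpha> *\<^sub>R v 0"
      "r (k + 2) = (\<Sum>i=1..k. v i) + \<beta> *\<^sub>R v 0"
  shows "(\<Sum>i=1..k + 2. c i *\<^sub>R r i) = 0 \<longleftrightarrow>
    (\<forall>i\<in>{1..k}. c i = - (c (k + 1) + c (k + 2))) \<and>
    c (k + 1) * (\<alpha> - sum s {1..k}) + c (k + 2) * (\<beta> - sum s {1..k}) = 0"
    (is "_ \<longleftrightarrow> ?R")
proof -
  define h where "h = (\<Sum>i=1..k. c i * s i) + c (k + 1) * \<alpha> + c (k + 2) * \<beta>"
  \<comment> \<open>The coefficient of \<open>v i\<close> in the combination; \<open>h\<close> is that of \<open>v 0\<close>.\<close>
  define e where "e i = (if i = 0 then h else c i + c (k + 1) + c (k + 2))" for i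
  have "(\<Sum>i=1..k + 2. c i *\<^sub>R r i)
      = (\<Sum>i=1..k. c i *\<^sub>R r i) + c (k + 1) *\<^sub>R r (k + 1) + c (k + 2) *\<^sub>R r (k + 2)"
    by simp
  also have "(\<Sum>i=1..k. c i *\<^sub>R r i) = (\<Sum>i=1..k. c i *\<^sub>R v i) + (\<Sum>i=1..k. c i * s i) *\<^sub>R v 0"
    by (simp add: r(1) scaleR_right_distrib sum.distrib scaleR_sum_left)
  also have "(\<Sum>i=1..k. c i *\<^sub>R v i) + (\<Sum>i=1..k. c i * s i) *\<^sub>R v 0
      + c (k + 1) *\<^sub>R r (k + 1) + c (k + 2) *\<^sub>R r (k + 2)
      = h *\<^sub>R v 0 + (\<Sum>i=1..k. (c i + c (k + 1) + c (k + 2)) *\<^sub>R v i)"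
    unfolding r h_def by (simp add: algebra_simps sum.distrib scaleR_sum_right)
  also have "\<dots> = (\<Sum>i=0..k. e i *\<^sub>R v i)"
    by (subst (2) sum.atLeast_Suc_atMost) (auto simp: e_def intro!: sum.cong)
  finally have "(\<Sum>i=1..k + 2. c i *\<^sub>R r i) = 0 \<longleftrightarrow> (\<forall>i\<in>{0..k}. e i = 0)"
    using lin_indep_familyD[OF assms(1), of e] by auto
  also have "\<dots> \<longleftrightarrow> h = 0 \<and> (\<forall>i\<in>{1..k}. c i + c (k + 1) + c (k + 2) = 0)"
    by (force simp: e_def)
  also have "\<dots> \<longleftrightarrow> ?R"
  proof -
    have "h = c (k + 1) * (\<alpha> - sum s {1..k}) + c (k + 2) * (\<beta> - sum s {1..k})"
      if "\<forall>i\<in>{1..k}. c i = - (c (k + 1) + c (k + 2))"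
    proof -
      have "(\<Sum>i=1..k. c i * s i) = - (c (k + 1) + c (k + 2)) * sum s {1..k}"
        unfolding sum_distrib_left using that by (intro sum.cong) auto
      then show ?thesis unfolding h_def by (simp add: algebra_simps)
    qed
    moreover have "c i + c (k + 1) + c (k + 2) = 0 \<longleftrightarrow> c i = - (c (k + 1) + c (k + 2))" for i
      by linarith
    ultimately show ?thesis by auto
  qed
  finally show ?thesis .
qed

text \<open>
  The relations are the multiples of the one with coefficients \<open>\<beta> - S\<close> and \<open>S - \<alpha>\<close> at the last
  two vectors and \<open>\<alpha> - \<beta>\<close> at all others, where \<open>S = sum s {1..k}\<close>.  The inequalities
  say that no coefficient vanishes, so a relation that omits one vector is trivial.
\<close>

lemma graph_family_circuit:
  fixes v :: "nat \<Rightarrow> 'a::real_vector"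
  assumes "lin_indep_family {0..k} v"
    and r: "\<And>i. i \<in> {1..k} \<Longrightarrow> r i = v i + s i *\<^sub>R v 0"
      "r (k + 1) = (\<Sum>i=1..k. v i) + \<alpha> *\<^sub>R v 0"
      "r (k + 2) = (\<Sum>i=1..k. v i) + \<beta> *\<^sub>R v 0"
    and ne: "\<alpha> \<noteq> \<beta>" "sum s {1..k} \<noteq> \<alpha>" "sum s {1..k} \<noteq> \<beta>"
  shows "\<not> lin_indep_family {1..k + 2} r"
    and "j \<in> {1..k + 2} \<Longrightarrow> lin_indep_family ({1..k + 2} - {j}) r"
proof -
  have rel: "(\<Sum>i=1..k + 2. c i *\<^sub>R r i) = 0 \<longleftrightarrow>
    (\<forall>i\<in>{1..k}. c i = - (c (k + 1) + c (k + 2))) \<and>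
    c (k + 1) * (\<alpha> - sum s {1..k}) + c (k + 2) * (\<beta> - sum s {1..k}) = 0" for c
    by (rule graph_family_relation_iff[OF assms(1) r])
  define S where "S = sum s {1..k}"
  define c where "c i = (if i = k + 1 then \<beta> - S else if i = k + 2 then S - \<alpha> else \<alpha> - \<beta>)" for i
  have "(\<Sum>i=1..k + 2. c i *\<^sub>R r i) = 0"
    unfolding rel by (auto simp: c_def S_def algebra_simps)
  moreover have "c (k + 1) \<noteq> 0" using ne by (simp add: c_def S_def)
  ultimately show "\<not> lin_indep_family {1..k + 2} r"
    using lin_indep_familyD[of "{1..k + 2}" r c "k + 1"] by auto
next
  have rel: "(\<Sum>i=1..k + 2. c i *\<^sub>R r i) = 0 \<longleftrightarrow>
    (\<forall>i\<in>{1..k}. c i = - (c (k + 1) + c (k + 2))) \<and>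
    c (k + 1) * (\<alpha> - sum s {1..k}) + c (k + 2) * (\<beta> - sum s {1..k}) = 0" for c
    by (rule graph_family_relation_iff[OF assms(1) r])
  assume j: "j \<in> {1..k + 2}"
  show "lin_indep_family ({1..k + 2} - {j}) r"
    unfolding lin_indep_family_def
  proof (intro allI impI)
    fix c assume 0: "(\<Sum>i\<in>{1..k + 2} - {j}. c i *\<^sub>R r i) = 0"
    \<comment> \<open>Extend the relation by \<open>0\<close> at the omitted index.\<close>
    define e where "e = c(j := 0)"
    have "(\<Sum>i=1..k + 2. e i *\<^sub>R r i) = (\<Sum>i\<in>{1..k + 2} - {j}. c i *\<^sub>R r i)"
      by (rule sum.mono_neutral_cong_right) (auto simp: e_def)
    with 0 have e: "\<And>i. i \<in> {1..k} \<Longrightarrow> e i = - (e (k + 1) + e (k + 2))"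
      "e (k + 1) * (\<alpha> - sum s {1..k}) + e (k + 2) * (\<beta> - sum s {1..k}) = 0"
      by (metis rel)+
    have ej: "e j = 0" by (simp add: e_def)
    have "e (k + 1) = 0 \<and> e (k + 2) = 0"
    proof -
      consider "j = k + 1" | "j = k + 2" | "j \<in> {1..k}" using j by fastforce
      then show ?thesis
      proof cases
        case 3
        then have eq: "e (k + 2) = - e (k + 1)" using e(1)[of j] ej by simp
        then have "e (k + 1) * (\<alpha> - \<beta>) = 0" using e(2) by (simp add: algebra_simps)
        then show ?thesis using ne(1) eq by simp
      qed (use e(2) ej ne in auto)
    qed
    then have "e i = 0" if "i \<in> {1..k + 2}" for i
      using e(1)[of i] that by (cases "i \<le> k"; cases "i = k + 1"; cases "i = k + 2") auto
    then show "\<forall>i\<in>{1..k + 2} - {j}. c i = 0" unfolding e_def by (metis DiffE fun_upd_apply singletonI)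
  qed
qed

section \<open>Circuits in level sets\<close>

text \<open>
  Each vector of the circuit has, up to sign, the direction of a point of the level set;
  passing to these points rescales the vectors by nonzero factors, which does not affect
  independence.  The bound \<open>2 \<le> k\<close> cannot be lowered: a nonzero linear
  function on the circle takes no value at three points that are pairwise independent.
\<close>

lemma odd_function_level_circuit:
  fixes f :: "'a::euclidean_space \<Rightarrow> real"
  assumes cont: "continuous_on (sphere 0 1) f"
    and odd: "\<And>x. norm x = 1 \<Longrightarrow> f (- x) = - f x"
    and k: "2 \<le> k" "k < DIM('a)"
  obtains q c where "\<And>i. i \<in> {1..k + 2} \<Longrightarrow> norm (q i) = 1"
    "\<And>i. i \<in> {1..k + 2} \<Longrightarrow> f (q i) = c"
    "\<not> lin_indep_family {1..k + 2} q"
    "\<And>j. j \<in> {1..k + 2} \<Longrightarrow> lin_indep_family ({1..k + 2} - {j}) q"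
proof -
  obtain p c where p: "norm p = 1" and pair:
    "\<And>u. (\<And>s t. s *\<^sub>R u + t *\<^sub>R p = 0 \<Longrightarrow> s = 0 \<and> t = 0) \<Longrightarrow>
       \<exists>a b. a \<noteq> b \<and> f (sgn (u + a *\<^sub>R p)) = c \<and> f (sgn (- (u + b *\<^sub>R p))) = c"
    using odd_level_antipodal_pair[OF cont odd] by blast
  have "p \<noteq> 0" using p by auto
  then obtain v where v: "v 0 = p" "lin_indep_family {0..k} v"
    using exists_lin_indep_family_extending k(2) by blast
  define w where "w = (\<Sum>i=1..k. v i)"
  \<comment> \<open>Independence of the family in the form used below, with the coefficient of \<open>p\<close> set apart.\<close>
  have comb: "t = 0 \<and> (\<forall>i\<in>{1..k}. c i = 0)"
    if "(\<Sum>i=1..k. c i *\<^sub>R v i) + t *\<^sub>R p = 0" for c t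
  proof -
    have "(\<Sum>i=0..k. (c(0 := t)) i *\<^sub>R v i) = t *\<^sub>R p + (\<Sum>i=1..k. c i *\<^sub>R v i)"
      by (subst sum.atLeast_Suc_atMost) (auto simp: v intro!: sum.cong)
    also have "\<dots> = 0" using that by (simp add: add.commute)
    finally have *: "(c(0 := t)) i = 0" if "i \<in> {0..k}" for i
      using lin_indep_familyD[OF v(2)] that by blast
    show ?thesis using *[of 0] * by (force simp: fun_upd_def)
  qed
  have indw: "s = 0 \<and> t = 0" if "s *\<^sub>R w + t *\<^sub>R p = 0" for s t
    using comb[of "\<lambda>_. s" t] that k(1) unfolding w_def by (force simp: scaleR_sum_right)
  have indv: "s = 0 \<and> t = 0" if i: "i \<in> {1..k}" and "s *\<^sub>R v i + t *\<^sub>R p = 0" for i s t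
  proof -
    have "(\<Sum>j=1..k. (if j = i then s else 0) *\<^sub>R v j) = s *\<^sub>R v i"
      using i by (simp add: if_distrib[of "\<lambda>x. x *\<^sub>R _"] cong: if_cong)
    then have "t = 0 \<and> (\<forall>j\<in>{1..k}. (if j = i then s else 0) = 0)"
      using comb[of "\<lambda>j. if j = i then s else 0" t] that(2) by simp
    then show ?thesis using i by (metis (full_types))
  qed
  obtain \<alpha> \<beta> where w: "\<alpha> \<noteq> \<beta>" "f (sgn (w + \<alpha> *\<^sub>R p)) = c" "f (sgn (- (w + \<beta> *\<^sub>R p))) = c"
    using pair[OF indw] by blast
  have "\<forall>i\<in>{1..k}. \<exists>a b. a \<noteq> b \<and> f (sgn (v i + a *\<^sub>R p)) = c \<and> f (sgn (- (v i + b *\<^sub>R p))) = c"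
    using pair indv by blast
  then obtain a b where ab: "\<And>i. i \<in> {1..k} \<Longrightarrow> a i \<noteq> b i"
      "\<And>i. i \<in> {1..k} \<Longrightarrow> f (sgn (v i + a i *\<^sub>R p)) = c"
      "\<And>i. i \<in> {1..k} \<Longrightarrow> f (sgn (- (v i + b i *\<^sub>R p))) = c"
    by metis
  obtain s where s: "\<And>i. s i = a i \<or> s i = b i" "sum s {1..k} \<noteq> \<alpha>" "sum s {1..k} \<noteq> \<beta>"
    using binary_choices_sum_avoiding_two_values[of "{1..k}" a b \<alpha> \<beta>] ab(1) k(1) by auto
  define r where "r i = (if i = k + 1 then w + \<alpha> *\<^sub>R p else if i = k + 2 then w + \<beta> *\<^sub>R p
                         else v i + s i *\<^sub>R p)" for i
  have nz: "r i \<noteq> 0" if "i \<in> {1..k + 2}" for i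
  proof -
    have "w + t *\<^sub>R p \<noteq> 0" for t using indw[of 1 t] by auto
    moreover have "v i + t *\<^sub>R p \<noteq> 0" if "i \<in> {1..k}" for t using indv[OF that, of 1 t] by auto
    ultimately show ?thesis using that by (auto simp: r_def)
  qed
  have "\<exists>\<epsilon>\<in>{1,-1}. f (\<epsilon> *\<^sub>R sgn (r i)) = c" if i: "i \<in> {1..k + 2}" for i
  proof -
    consider "i = k + 1" | "i = k + 2" | "i \<in> {1..k}" using i by fastforce
    then show ?thesis
    proof cases
      case 3
      then show ?thesis using s(1)[of i] ab(2,3)[of i] by (auto simp: r_def sgn_minus simp flip: minus_add_distrib)
    qed (use w in \<open>auto simp: r_def sgn_minus simp del: minus_add_distrib\<close>)
  qed
  then obtain \<epsilon> :: "nat \<Rightarrow> real" where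
    \<epsilon>: "\<And>i. i \<in> {1..k + 2} \<Longrightarrow> \<epsilon> i \<in> {1,-1}" "\<And>i. i \<in> {1..k + 2} \<Longrightarrow> f (\<epsilon> i *\<^sub>R sgn (r i)) = c"
    by metis
  \<comment> \<open>The factor that carries \<open>r i\<close> to the corresponding point of the level set.\<close>
  define \<mu> where "\<mu> i = \<epsilon> i / norm (r i)" for i
  have \<mu>: "\<mu> i \<noteq> 0" if "i \<in> {1..k + 2}" for i using nz[OF that] \<epsilon>(1)[OF that] by (auto simp: \<mu>_def)
  have eq: "\<mu> i *\<^sub>R r i = \<epsilon> i *\<^sub>R sgn (r i)" for i by (simp add: \<mu>_def sgn_div_norm divide_inverse)
  have circ: "\<not> lin_indep_family {1..k + 2} r"
    "\<And>j. j \<in> {1..k + 2} \<Longrightarrow> lin_indep_family ({1..k + 2} - {j}) r"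
    by (rule graph_family_circuit[OF v(2) _ _ _ w(1) s(2,3)]; simp add: r_def v(1) w_def)+
  show ?thesis
  proof (rule that[of "\<lambda>i. \<mu> i *\<^sub>R r i" c])
    fix i assume i: "i \<in> {1..k + 2}"
    show "norm (\<mu> i *\<^sub>R r i) = 1" unfolding eq using \<epsilon>(1)[OF i] nz[OF i] by (auto simp: norm_sgn)
    show "f (\<mu> i *\<^sub>R r i) = c" unfolding eq using \<epsilon>(2)[OF i] .
    show "lin_indep_family ({1..k + 2} - {i}) (\<lambda>i. \<mu> i *\<^sub>R r i)"
      using circ(2)[OF i] \<mu> by (subst lin_indep_family_scaleR_iff) auto
  next
    show "\<not> lin_indep_family {1..k + 2} (\<lambda>i. \<mu> i *\<^sub>R r i)"
      using circ(1) \<mu> by (subst lin_indep_family_scaleR_iff) auto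
  qed
qed

lemma N'_le:
  assumes "2 \<le> j" "j \<le> m + 1" "odd ((m + 1) choose j)"
  shows "N' m \<le> j"
  unfolding N'_def
proof (rule Min_le)
  show "finite {j. 2 \<le> j \<and> j \<le> m + 1 \<and> [(m + 1) choose j = 1] (mod 2)}"
    by (rule finite_subset[of _ "{..m + 1}"]) auto
  show "j \<in> {j. 2 \<le> j \<and> j \<le> m + 1 \<and> [(m + 1) choose j = 1] (mod 2)}"
    using assms by (simp add: cong_def odd_iff_mod_2_eq_one)
qed

theorem theorem4p8:
  fixes m d :: nat
    and f :: "real ^ 'n \<Rightarrow> real ^ 'd"
  assumes "m \<ge> 1" and "d \<ge> 1"
    and "CARD('n) = m + 1" and "CARD('d) = d"
    and "continuous_on (sphere 0 1) f"
    and "\<forall>p \<in> sphere 0 1. f (- p) = - f p"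
    and "m * d < N' m"
  shows "\<exists>p :: nat \<Rightarrow> real ^ 'n.
           (\<forall>i \<in> {1..m + 1}. p i \<in> sphere 0 1) \<and>
           (\<forall>i \<in> {1..m + 1}. \<forall>j \<in> {1..m + 1}. f (p i) = f (p j)) \<and>
           \<not> lin_indep_family {1..m + 1} p \<and>
           (\<forall>I. I \<subseteq> {1..m + 1} \<and> card I = m \<longrightarrow> lin_indep_family I p)"
proof (cases "m = 1")
  case True
  obtain e :: "real ^ 'n" where e: "norm e = 1" using vector_choose_size[of 1] by auto
  have "\<not> lin_indep_family {1..2::nat} (\<lambda>_. e)"
  proof
    assume "lin_indep_family {1..2::nat} (\<lambda>_. e)"
    from lin_indep_familyD[OF this, of "\<lambda>i. if i = 1 then 1 else -1" 1] show False
      by (simp add: numeral_2_eq_2)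
  qed
  moreover have "lin_indep_family I (\<lambda>_. e)" if I: "card I = 1" for I :: "nat set"
  proof -
    obtain i where "I = {i}" using I by (auto simp: card_1_singleton_iff)
    then show ?thesis using e unfolding lin_indep_family_def by auto
  qed
  ultimately show ?thesis using True e by (intro exI[of _ "\<lambda>_. e"]) (auto simp: numeral_2_eq_2)
next
  case False
  have "N' m \<le> m + 1" using assms(1) by (intro N'_le) auto
  then have "m * d < m * 2" using assms(1,7) False by linarith
  then have d: "CARD('d) = 1" using assms(2,4) by auto
  have "m \<noteq> 2"
  proof
    assume "m = 2"
    moreover have "(2 + 1) choose 2 = (3::nat)" by (simp add: choose_two)
    then have "N' 2 \<le> 2" by (intro N'_le) auto
    ultimately show False using assms(2,7) by simp
  qed
  then have m: "m \<ge> 3" using assms(1) False by linarith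
  define k where "k = m - 1"
  have k: "2 \<le> k" "k < DIM(real ^ 'n)" "m + 1 = k + 2" using m assms(3) by (auto simp: k_def)
  obtain l :: 'd where l: "UNIV = {l}" using d card_1_singletonE by blast
  have f_eq: "f x = f y \<longleftrightarrow> f x $ l = f y $ l" for x y
    using l by (metis UNIV_I singletonD vec_eq_iff)
  have "continuous_on (sphere 0 1) (\<lambda>x. f x $ l)" using assms(5) by (intro continuous_intros)
  moreover have "f (- x) $ l = - (f x $ l)" if "norm x = 1" for x using assms(6) that by simp
  ultimately obtain q c where q: "\<And>i. i \<in> {1..k + 2} \<Longrightarrow> norm (q i) = 1"
    "\<And>i. i \<in> {1..k + 2} \<Longrightarrow> f (q i) $ l = c"
    "\<not> lin_indep_family {1..k + 2} q"
    "\<And>j. j \<in> {1..k + 2} \<Longrightarrow> lin_indep_family ({1..k + 2} - {j}) q"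
    using odd_function_level_circuit[of "\<lambda>x. f x $ l" k] k(1,2) by metis
  have "lin_indep_family I q" if I: "I \<subseteq> {1..k + 2}" "card I = m" for I
  proof -
    have "I \<noteq> {1..k + 2}" using I(2) k(3) by auto
    then obtain j where "j \<in> {1..k + 2}" "I \<subseteq> {1..k + 2} - {j}" using I(1) by blast
    then show ?thesis using lin_indep_family_subset q(4) by (metis finite_Diff finite_atLeastAtMost)
  qed
  then show ?thesis unfolding k(3) using q f_eq by (intro exI[of _ q]) auto
qed

end
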